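(* Let $\mathcal{H}$ be a two-dimensional complex Hilbert space and let $\{A_n\}_{n\in\mathbb{Z}}$, $\{B_n\}_{n\in\mathbb{Z}}$, $\{C_n\}_{n\in\mathbb{Z}}\subseteq\boldsymbol{B}(\mathcal{H})$. Assume that $U\in\boldsymbol{B}(\ell_2(\mathbb{Z},\mathcal{H}))$ is a unitary operator with matrix entries $U_{n,n-1}=A_n$, $U_{n,n}=B_n$, $U_{n,n+1}=C_n$ for all $n\in\mathbb{Z}$, and $U_{i,j}=0$ whenever $|i-j|\ge 2$, and that $1\in\sigma(C_kC_k^* )\cap\sigma(C_{k+1}C_{k+1}^* )$ for some $k\in\mathbb{Z}$. Let $S\in\boldsymbol{B}(\ell_2(\mathbb{Z},\mathcal{H}))$ be such that $S$ and $USU^*$ are bilateral operator valued weighted shifts on $\mathcal{H}$ with invertible weights. Then at least one of the sequences $\{A_n\}_{n\in\mathbb{Z}}$, $\{B_n\}_{n\in\mathbb{Z}}$, $\{C_n\}_{n\in\mathbb{Z}}$ consists of zero operators only.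
   Context: $\boldsymbol{B}(\mathcal{K})$ is the algebra of bounded linear operators on a Hilbert space $\mathcal{K}$, and $\sigma(A)$ is the spectrum of an operator $A$. $\ell_2(\mathbb{Z},\mathcal{H})=\bigoplus_{n\in\mathbb{Z}}\mathcal{H}$ is the Hilbert space of two-sided sequences $x=(x_n)_{n\in\mathbb{Z}}$ in $\mathcal{H}$ with $\sum_{n}\|x_n\|^2<\infty$. Every $U\in\boldsymbol{B}(\ell_2(\mathbb{Z},\mathcal{H}))$ is identified with its operator matrix $[U_{i,j}]_{i,j\in\mathbb{Z}}$, $U_{i,j}\in\boldsymbol{B}(\mathcal{H})$, where $(Ux)_i=\sum_j U_{i,j}x_j$. Bilateral operator valued weighted shift: given a two-sided sequence $\{S_n\}_{n\in\mathbb{Z}}\subseteq\boldsymbol{B}(\mathcal{H})$ of nonzero operators with $\{\|S_n\|\}_{n\in\mathbb{Z}}$ bounded, it is the operator $S\in\boldsymbol{B}(\ell_2(\mathbb{Z},\mathcal{H}))$ defined by $(Sx)_n=S_n x_{n-1}$, $n\in\mathbb{Z}$; the $S_n$ are its weights. *)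

theory Defs
  imports "HOL-Analysis.Analysis"
begin

section \<open>Complex Hilbert spaces\<close>

class complex_vector = real_vector +
  fixes scaleC :: "complex \<Rightarrow> 'a \<Rightarrow> 'a" (infixr "*\<^sub>C" 75)
  assumes scaleC_add_right: "c *\<^sub>C (x + y) = c *\<^sub>C x + c *\<^sub>C y"
    and scaleC_add_left: "(c + d) *\<^sub>C x = c *\<^sub>C x + d *\<^sub>C x"
    and scaleC_scaleC: "c *\<^sub>C d *\<^sub>C x = (c * d) *\<^sub>C x"
    and scaleC_one: "1 *\<^sub>C x = x"
    and scaleR_eq_scaleC: "r *\<^sub>R x = complex_of_real r *\<^sub>C x"

global_interpretation complex_vector: vector_space "scaleC :: complex \<Rightarrow> 'a \<Rightarrow> 'a :: complex_vector"
  by unfold_locales (simp_all add: scaleC_add_right scaleC_add_left scaleC_scaleC scaleC_one)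

text \<open>The inner product is linear in its first and conjugate-linear in its second argument. The
  inherited real inner product is tied to it as its real part, so that the inherited norm is
  \<open>x \<mapsto> sqrt (cinner x x)\<close>; positive definiteness is likewise inherited.\<close>

class complex_inner = complex_vector + real_inner +
  fixes cinner :: "'a \<Rightarrow> 'a \<Rightarrow> complex"
  assumes cinner_commute: "cinner x y = cnj (cinner y x)"
    and cinner_add_left: "cinner (x + y) z = cinner x z + cinner y z"
    and cinner_scaleC_left: "cinner (c *\<^sub>C x) y = c * cinner x y"
    and inner_eq_Re_cinner: "inner x y = Re (cinner x y)"

class chilbert_space = complex_inner + complete_space

lemma cinner_self: "cinner x x = complex_of_real ((norm x)\<^sup>2)"
  using arg_cong[OF cinner_commute[of x x], of Im]
  by (simp add: complex_eq_iff power2_norm_eq_inner inner_eq_Re_cinner)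

lemma cinner_scaleC_right: "cinner x (c *\<^sub>C y) = cnj c * cinner x y"
  unfolding cinner_commute[of x] by (simp add: cinner_scaleC_left)

lemma cinner_add_right: "cinner x (y + z) = cinner x y + cinner x z"
  unfolding cinner_commute[of x] by (simp add: cinner_add_left)

lemma cinner_eq_Complex: "cinner x y = Complex (inner x y) (inner x (\<i> *\<^sub>C y))"
  by (simp add: complex_eq_iff inner_eq_Re_cinner cinner_scaleC_right)

lemma norm_scaleC: "norm (c *\<^sub>C x) = cmod c * norm (x :: 'a :: complex_inner)"
proof -
  have "complex_of_real ((norm (c *\<^sub>C x))\<^sup>2) = complex_of_real ((cmod c * norm x)\<^sup>2)"
    unfolding cinner_self[symmetric] cinner_scaleC_left cinner_scaleC_right power_mult_distrib
      of_real_mult by (simp add: complex_norm_square mult_ac flip: of_real_power)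
  then have "(norm (c *\<^sub>C x))\<^sup>2 = (cmod c * norm x)\<^sup>2"
    unfolding of_real_eq_iff .
  then show ?thesis
    by (simp add: power2_eq_iff_nonneg)
qed

lemma bounded_linear_scaleC: "bounded_linear (\<lambda>x :: 'a :: complex_inner. c *\<^sub>C x)"
  by (rule bounded_linear_intro[of _ "cmod c"])
    (simp_all add: scaleC_add_right scaleR_eq_scaleC scaleC_scaleC norm_scaleC mult_ac)

lemma cinner_ext:
  assumes "\<And>z. cinner z x = cinner z y"
  shows "x = y"
proof -
  have "inner (x - y) x = inner (x - y) y"
    using assms[of "x - y"] by (simp add: inner_eq_Re_cinner)
  then have "inner (x - y) (x - y) = 0"
    by (simp add: inner_diff_right)
  then show ?thesis by simp
qed

section \<open>Bounded operators\<close>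

definition bounded_ops :: "('a :: complex_inner \<Rightarrow> 'a) set" where
  "bounded_ops = {A. bounded_linear A \<and> (\<forall>c x. A (c *\<^sub>C x) = c *\<^sub>C A x)}"

definition op_invertible :: "('a :: complex_inner \<Rightarrow> 'a) \<Rightarrow> bool" where
  "op_invertible A \<longleftrightarrow> A \<in> bounded_ops \<and> (\<exists>B \<in> bounded_ops. A \<circ> B = id \<and> B \<circ> A = id)"

definition op_spectrum :: "('a :: complex_inner \<Rightarrow> 'a) \<Rightarrow> complex set" where
  "op_spectrum A = {c. \<not> op_invertible (\<lambda>x. A x - c *\<^sub>C x)}"

definition adjoint_op :: "('a :: chilbert_space \<Rightarrow> 'a) \<Rightarrow> 'a \<Rightarrow> 'a" where
  "adjoint_op A = (THE B. B \<in> bounded_ops \<and> (\<forall>x y. cinner (A x) y = cinner x (B y)))"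

definition unitary_op :: "('a :: chilbert_space \<Rightarrow> 'a) \<Rightarrow> bool" where
  "unitary_op U \<longleftrightarrow> U \<in> bounded_ops \<and> adjoint_op U \<circ> U = id \<and> U \<circ> adjoint_op U = id"

text \<open>Riesz representation by minimising \<open>\<parallel>x\<parallel>\<^sup>2 - 2 f x\<close>; it is needed to see that
  \<^const>\<open>adjoint_op\<close> is well defined.\<close>

lemma riesz_real:
  fixes f :: "'a :: {real_inner, complete_space} \<Rightarrow> real"
  assumes f: "bounded_linear f"
  shows "\<exists>z. \<forall>x. f x = inner x z"
proof -
  interpret f: bounded_linear f by fact
  define g where "g x = (norm x)\<^sup>2 - 2 * f x" for x
  obtain K where K: "\<And>x. norm (f x) \<le> norm x * K"
    using f.bounded by blast
  have low: "- K\<^sup>2 \<le> g x" for x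
  proof -
    have "0 \<le> (norm x - K)\<^sup>2" by simp
    then have "2 * (norm x * K) \<le> (norm x)\<^sup>2 + K\<^sup>2"
      by (simp add: power2_eq_square algebra_simps)
    then show ?thesis using K[of x] by (simp add: g_def)
  qed
  define m where "m = Inf (range g)"
  have bdd: "bdd_below (range g)"
    using low by (intro bdd_belowI[of _ "- K\<^sup>2"]) auto
  have m_le: "m \<le> g x" for x
    unfolding m_def by (rule cInf_lower[OF _ bdd]) simp
  have "\<exists>x. g x < m + inverse (real (Suc n))" for n
    using cInf_lessD[of "range g" "m + inverse (real (Suc n))"] by (auto simp: m_def)
  then obtain X where X: "\<And>n. g (X n) < m + inverse (real (Suc n))"
    by metis
  have par: "(norm (x - y))\<^sup>2 \<le> 2 * (g x - m) + 2 * (g y - m)" for x y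
  proof -
    have "(norm (x - y))\<^sup>2 = 2 * g x + 2 * g y - 4 * g ((1/2) *\<^sub>R (x + y))"
      by (simp add: g_def power2_norm_eq_inner f.scaleR f.add inner_add inner_diff
        inner_commute[of y x] algebra_simps)
    then show ?thesis using m_le[of "(1/2) *\<^sub>R (x + y)"] by simp
  qed
  have "Cauchy X"
  proof (rule CauchyI)
    fix e :: real assume "0 < e"
    then have "0 < e\<^sup>2 / 4" by simp
    then obtain N where N: "inverse (real (Suc N)) < e\<^sup>2 / 4"
      using reals_Archimedean by blast
    show "\<exists>M. \<forall>k\<ge>M. \<forall>l\<ge>M. norm (X k - X l) < e"
    proof (intro exI allI impI)
      fix k l assume "N \<le> k" "N \<le> l"
      have *: "g (X i) - m < e\<^sup>2 / 4" if "N \<le> i" for i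
      proof -
        have "inverse (real (Suc i)) \<le> inverse (real (Suc N))"
          using that by (intro le_imp_inverse_le) auto
        with X[of i] N show ?thesis by linarith
      qed
      have "(norm (X k - X l))\<^sup>2 < e\<^sup>2"
        using par[of "X k" "X l"] *[OF \<open>N \<le> k\<close>] *[OF \<open>N \<le> l\<close>] by simp
      then show "norm (X k - X l) < e"
        using \<open>0 < e\<close> by (simp add: power_less_imp_less_base)
    qed
  qed
  then obtain z where z: "X \<longlonglongrightarrow> z"
    using Cauchy_convergent convergent_def by blast
  have "(\<lambda>n. g (X n)) \<longlonglongrightarrow> g z"
    unfolding g_def by (intro tendsto_intros f.tendsto z)
  moreover have "(\<lambda>n. m + inverse (real (Suc n))) \<longlonglongrightarrow> m + 0"
    by (intro tendsto_intros LIMSEQ_inverse_real_of_nat)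
  ultimately have "g z \<le> m"
    using X by (intro LIMSEQ_le[of "\<lambda>n. g (X n)" "g z" "\<lambda>n. m + inverse (real (Suc n))" m])
      (auto intro: less_imp_le)
  then have min: "g z \<le> g x" for x
    using m_le[of x] by linarith
  have "f x = inner x z" for x
  proof (rule ccontr)
    define d where "d = f x - inner x z"
    assume "f x \<noteq> inner x z"
    then have "d \<noteq> 0" by (simp add: d_def)
    then have "x \<noteq> 0" by (auto simp: d_def f.zero)
    then have n0: "inner x x > 0" by simp
    define t where "t = d / inner x x"
    have "g (z + t *\<^sub>R x) = g z + t\<^sup>2 * inner x x - 2 * t * d"
      by (simp add: g_def d_def power2_norm_eq_inner f.scaleR f.add inner_add
        inner_commute[of z x] algebra_simps) (simp add: power2_eq_square)
    moreover have "t\<^sup>2 * inner x x - 2 * t * d = - (d\<^sup>2 / inner x x)"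
      using n0 by (simp add: t_def field_simps power2_eq_square)
    moreover have "d\<^sup>2 / inner x x > 0"
      using n0 \<open>d \<noteq> 0\<close> by simp
    ultimately show False using min[of "z + t *\<^sub>R x"] by linarith
  qed
  then show ?thesis by blast
qed

lemma adjoint_exists:
  fixes A :: "'a :: chilbert_space \<Rightarrow> 'a"
  assumes A: "A \<in> bounded_ops"
  shows "\<exists>!B. B \<in> bounded_ops \<and> (\<forall>x y. cinner (A x) y = cinner x (B y))"
proof -
  have bl: "bounded_linear A" and sc: "\<And>c x. A (c *\<^sub>C x) = c *\<^sub>C A x"
    using A by (auto simp: bounded_ops_def)
  have "\<exists>z. \<forall>x. inner (A x) y = inner x z" for y
    by (rule riesz_real) (intro bounded_linear_inner_left_comp bl)
  then obtain B where B: "\<And>x y. inner (A x) y = inner x (B y)"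
    by metis
  have CB: "cinner (A x) y = cinner x (B y)" for x y
  proof -
    have "Re (cinner (A x) y) = Re (cinner x (B y))" for x
      using B[of x y] by (simp add: inner_eq_Re_cinner)
    from this[of x] this[of "\<i> *\<^sub>C x"] show ?thesis
      by (simp add: sc cinner_scaleC_left complex_eq_iff)
  qed
  have Badd: "B (x + y) = B x + B y" for x y
    by (rule cinner_ext) (simp add: cinner_add_right flip: CB)
  have Bsc: "B (c *\<^sub>C x) = c *\<^sub>C B x" for c x
    by (rule cinner_ext) (simp add: cinner_scaleC_right flip: CB)
  obtain K where K: "\<And>x. norm (A x) \<le> norm x * K"
    using bounded_linear.bounded[OF bl] by blast
  have "bounded_linear B"
  proof (rule bounded_linear_intro[of _ K])
    fix y
    show "norm (B y) \<le> norm y * K"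
    proof (cases "B y = 0")
      case True
      have "0 \<le> norm (A y)" by simp
      also have "\<dots> \<le> norm y * K" by (rule K)
      finally show ?thesis using True by simp
    next
      case False
      have "norm (B y) * norm (B y) = inner (A (B y)) y"
        by (simp add: B flip: power2_norm_eq_inner power2_eq_square)
      also have "\<dots> \<le> norm (A (B y)) * norm y"
        by (rule norm_cauchy_schwarz)
      also have "\<dots> \<le> norm (B y) * K * norm y"
        by (intro mult_right_mono K) simp
      finally show ?thesis using False by (simp add: mult_ac)
    qed
  qed (simp_all add: Badd Bsc scaleR_eq_scaleC)
  then have "B \<in> bounded_ops"
    by (simp add: bounded_ops_def Bsc)
  moreover have "B' = B" if "\<forall>x y. cinner (A x) y = cinner x (B' y)" for B'
    by (rule ext, rule cinner_ext) (use that CB in metis)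
  ultimately show ?thesis using CB by blast
qed

lemma adjoint_op:
  assumes "A \<in> bounded_ops"
  shows "adjoint_op A \<in> bounded_ops" "cinner (A x) y = cinner x (adjoint_op A y)"
  using theI'[OF adjoint_exists[OF assms]] unfolding adjoint_op_def by blast+

section \<open>The space of square-summable two-sided sequences\<close>

typedef (overloaded) 'a ell2 = "{x :: int \<Rightarrow> 'a :: real_normed_vector. (\<lambda>n. (norm (x n))\<^sup>2) summable_on UNIV}"
  morphisms ell2_nth Abs_ell2
  by (rule exI[of _ "\<lambda>_. 0"]) simp

setup_lifting type_definition_ell2

lemma ell2_eqI: "(\<And>n. ell2_nth x n = ell2_nth y n) \<Longrightarrow> x = y"
  by transfer auto

lemma square_summable_add:
  fixes x y :: "int \<Rightarrow> 'a :: real_normed_vector"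
  assumes "(\<lambda>n. (norm (x n))\<^sup>2) summable_on UNIV" "(\<lambda>n. (norm (y n))\<^sup>2) summable_on UNIV"
  shows "(\<lambda>n. (norm (x n + y n))\<^sup>2) summable_on UNIV"
proof (rule summable_on_comparison_test)
  show "(\<lambda>n. 2 * (norm (x n))\<^sup>2 + 2 * (norm (y n))\<^sup>2) summable_on UNIV"
    by (intro summable_on_add summable_on_cmult_right assms)
  show "(norm (x n + y n))\<^sup>2 \<le> 2 * (norm (x n))\<^sup>2 + 2 * (norm (y n))\<^sup>2" for n
  proof -
    have "(norm (x n + y n))\<^sup>2 \<le> (norm (x n) + norm (y n))\<^sup>2"
      by (intro power_mono norm_triangle_ineq) simp
    also have "\<dots> \<le> 2 * (norm (x n))\<^sup>2 + 2 * (norm (y n))\<^sup>2"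
      using sum_squares_bound[of "norm (x n)" "norm (y n)"]
      by (simp add: power2_eq_square algebra_simps)
    finally show ?thesis .
  qed
qed simp

lemma square_summable_scale:
  fixes x :: "int \<Rightarrow> 'a :: real_normed_vector"
  assumes "(\<lambda>n. (norm (x n))\<^sup>2) summable_on UNIV" "\<And>n. norm (y n) = c * norm (x n)"
  shows "(\<lambda>n. (norm (y n))\<^sup>2) summable_on UNIV"
  using summable_on_cmult_right[OF assms(1), of "c\<^sup>2"]
  by (simp add: assms(2) power_mult_distrib)

lemma inner_summable:
  fixes x y :: "int \<Rightarrow> 'a :: real_inner"
  assumes "(\<lambda>n. (norm (x n))\<^sup>2) summable_on UNIV" "(\<lambda>n. (norm (y n))\<^sup>2) summable_on UNIV"
  shows "(\<lambda>n. inner (x n) (y n)) summable_on UNIV"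
proof -
  have "(\<lambda>n. (norm (x n))\<^sup>2 + (norm (y n))\<^sup>2) summable_on UNIV"
    by (intro summable_on_add assms)
  moreover have "norm (inner (x n) (y n)) \<le> (norm (x n))\<^sup>2 + (norm (y n))\<^sup>2" for n
  proof -
    have "\<bar>inner (x n) (y n)\<bar> \<le> norm (x n) * norm (y n)"
      by (rule Cauchy_Schwarz_ineq2)
    moreover have "0 \<le> norm (x n) * norm (y n)" by simp
    moreover have "2 * norm (x n) * norm (y n) \<le> (norm (x n))\<^sup>2 + (norm (y n))\<^sup>2"
      by (rule sum_squares_bound)
    ultimately show ?thesis unfolding real_norm_def by linarith
  qed
  ultimately have "(\<lambda>n. norm (inner (x n) (y n))) summable_on UNIV"
    by (rule Infinite_Sum.abs_summable_on_comparison_test')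
  then show ?thesis by (rule abs_summable_summable)
qed

lemma cinner_summable:
  fixes x y :: "int \<Rightarrow> 'a :: complex_inner"
  assumes "(\<lambda>n. (norm (x n))\<^sup>2) summable_on UNIV" "(\<lambda>n. (norm (y n))\<^sup>2) summable_on UNIV"
  shows "(\<lambda>n. cinner (x n) (y n)) summable_on UNIV"
proof -
  have "(\<lambda>n. (norm (\<i> *\<^sub>C y n))\<^sup>2) summable_on UNIV"
    using assms(2) by (simp add: norm_scaleC)
  then have "(\<lambda>n. complex_of_real (inner (x n) (y n)) + \<i> * complex_of_real (inner (x n) (\<i> *\<^sub>C y n)))
      summable_on UNIV"
    by (intro summable_on_add summable_on_cmult_right summable_on_of_real inner_summable assms)
  then show ?thesis
    by (simp add: cinner_eq_Complex Complex_eq)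
qed

instantiation ell2 :: (real_normed_vector) real_vector
begin

lift_definition zero_ell2 :: "'a ell2" is "\<lambda>_. 0" by simp

lift_definition plus_ell2 :: "'a ell2 \<Rightarrow> 'a ell2 \<Rightarrow> 'a ell2" is "\<lambda>x y n. x n + y n"
  by (rule square_summable_add)

lift_definition uminus_ell2 :: "'a ell2 \<Rightarrow> 'a ell2" is "\<lambda>x n. - x n" by simp

lift_definition scaleR_ell2 :: "real \<Rightarrow> 'a ell2 \<Rightarrow> 'a ell2" is "\<lambda>r x n. r *\<^sub>R x n"
  subgoal for r x by (rule square_summable_scale[of x _ "\<bar>r\<bar>"]) simp_all
  done

definition minus_ell2 :: "'a ell2 \<Rightarrow> 'a ell2 \<Rightarrow> 'a ell2" where "minus_ell2 x y = x + (- y)"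

instance
  by standard (unfold minus_ell2_def, (transfer; simp add: algebra_simps)+)

end

instantiation ell2 :: (real_inner) real_inner
begin

definition inner_ell2 :: "'a ell2 \<Rightarrow> 'a ell2 \<Rightarrow> real" where
  "inner_ell2 x y = (\<Sum>\<^sub>\<infinity>n. inner (ell2_nth x n) (ell2_nth y n))"

definition norm_ell2 :: "'a ell2 \<Rightarrow> real" where
  "norm_ell2 x = sqrt (\<Sum>\<^sub>\<infinity>n. (norm (ell2_nth x n))\<^sup>2)"

definition sgn_ell2 :: "'a ell2 \<Rightarrow> 'a ell2" where "sgn_ell2 x = inverse (norm x) *\<^sub>R x"

definition dist_ell2 :: "'a ell2 \<Rightarrow> 'a ell2 \<Rightarrow> real" where "dist_ell2 x y = norm (x - y)"

definition uniformity_ell2 :: "('a ell2 \<times> 'a ell2) filter" where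
  "uniformity_ell2 = (INF e\<in>{0<..}. principal {(x, y). dist x y < e})"

definition open_ell2 :: "'a ell2 set \<Rightarrow> bool" where
  "open_ell2 U \<longleftrightarrow> (\<forall>x\<in>U. eventually (\<lambda>(x', y). x' = x \<longrightarrow> y \<in> U) uniformity)"

instance
proof
  fix x y z :: "'a ell2" and r :: real
  note sq = ell2_nth[unfolded mem_Collect_eq]
  note s = inner_summable[OF sq sq]
  show "dist x y = norm (x - y)" by (rule dist_ell2_def)
  show "sgn x = inverse (norm x) *\<^sub>R x" by (rule sgn_ell2_def)
  show "(uniformity :: ('a ell2 \<times> 'a ell2) filter) = (INF e\<in>{0<..}. principal {(x, y). dist x y < e})"
    by (rule uniformity_ell2_def)
  show "open U \<longleftrightarrow> (\<forall>x\<in>U. eventually (\<lambda>(x', y). x' = x \<longrightarrow> y \<in> U) uniformity)" for U :: "'a ell2 set"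
    by (rule open_ell2_def)
  show "inner x y = inner y x"
    unfolding inner_ell2_def by (intro infsum_cong inner_commute)
  show "inner (x + y) z = inner x z + inner y z"
    unfolding inner_ell2_def plus_ell2.rep_eq inner_add_left by (intro infsum_add s)
  show "inner (r *\<^sub>R x) y = r * inner x y"
    unfolding inner_ell2_def scaleR_ell2.rep_eq inner_scaleR_left by (rule infsum_cmult_right')
  show "0 \<le> inner x x"
    by (simp add: inner_ell2_def infsum_nonneg)
  show "inner x x = 0 \<longleftrightarrow> x = 0"
  proof
    assume "inner x x = 0"
    then have "(\<Sum>\<^sub>\<infinity>n. inner (ell2_nth x n) (ell2_nth x n)) \<le> 0"
      by (simp add: inner_ell2_def)
    then have "inner (ell2_nth x n) (ell2_nth x n) = 0" for n
      by (rule nonneg_infsum_le_0D[OF _ s]) simp_all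
    then show "x = 0"
      by (intro ell2_eqI) (simp add: zero_ell2.rep_eq)
  qed (simp add: inner_ell2_def zero_ell2.rep_eq)
  show "norm x = sqrt (inner x x)"
    unfolding norm_ell2_def inner_ell2_def power2_norm_eq_inner ..
qed

end

instantiation ell2 :: (complex_inner) complex_inner
begin

lift_definition scaleC_ell2 :: "complex \<Rightarrow> 'a ell2 \<Rightarrow> 'a ell2" is "\<lambda>c x n. c *\<^sub>C x n"
  subgoal for c x by (rule square_summable_scale[of x _ "cmod c"]) (simp_all add: norm_scaleC)
  done

definition cinner_ell2 :: "'a ell2 \<Rightarrow> 'a ell2 \<Rightarrow> complex" where
  "cinner_ell2 x y = (\<Sum>\<^sub>\<infinity>n. cinner (ell2_nth x n) (ell2_nth y n))"

instance
proof
  fix x y z :: "'a ell2" and c d :: complex and r :: real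
  note sq = ell2_nth[unfolded mem_Collect_eq]
  note s = cinner_summable[OF sq sq]
  show "c *\<^sub>C (x + y) = c *\<^sub>C x + c *\<^sub>C y"
    by transfer (simp add: scaleC_add_right)
  show "(c + d) *\<^sub>C x = c *\<^sub>C x + d *\<^sub>C x"
    by transfer (simp add: scaleC_add_left)
  show "c *\<^sub>C d *\<^sub>C x = (c * d) *\<^sub>C x"
    by transfer (simp add: scaleC_scaleC)
  show "1 *\<^sub>C x = x"
    by transfer (simp add: scaleC_one)
  show "r *\<^sub>R x = complex_of_real r *\<^sub>C x"
    by transfer (simp add: scaleR_eq_scaleC)
  show "cinner x y = cnj (cinner y x)"
    unfolding cinner_ell2_def infsum_cnj[symmetric] by (subst cinner_commute) (rule refl)
  show "cinner (x + y) z = cinner x z + cinner y z"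
    by (simp add: cinner_ell2_def plus_ell2.rep_eq cinner_add_left infsum_add s)
  show "cinner (c *\<^sub>C x) y = c * cinner x y"
    by (simp add: cinner_ell2_def scaleC_ell2.rep_eq cinner_scaleC_left infsum_cmult_right')
  show "inner x y = Re (cinner x y)"
    unfolding inner_ell2_def cinner_ell2_def infsum_Re[OF s, symmetric]
    by (intro infsum_cong inner_eq_Re_cinner)
qed

end

lemma ell2_nth_minus: "ell2_nth (x - y) n = ell2_nth x n - ell2_nth y n"
  unfolding minus_ell2_def plus_ell2.rep_eq uminus_ell2.rep_eq by simp

lemma sum_ell2_nth_le:
  fixes x :: "'a :: real_inner ell2"
  assumes "finite F"
  shows "(\<Sum>n\<in>F. (norm (ell2_nth x n))\<^sup>2) \<le> (norm x)\<^sup>2"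
  unfolding norm_ell2_def
  by (subst real_sqrt_pow2) (use ell2_nth[of x] assms in \<open>auto intro!: infsum_nonneg finite_sum_le_infsum\<close>)

lemma norm_ell2_nth_le: "norm (ell2_nth x n) \<le> norm (x :: 'a :: real_inner ell2)"
  using sum_ell2_nth_le[of "{n}" x] by (simp add: power2_le_iff_abs_le)

lemma norm_ell2_leI:
  fixes x :: "'a :: real_inner ell2"
  assumes "0 \<le> c" "\<And>F. finite F \<Longrightarrow> (\<Sum>n\<in>F. (norm (ell2_nth x n))\<^sup>2) \<le> c\<^sup>2"
  shows "norm x \<le> c"
  unfolding norm_ell2_def
  by (rule real_le_lsqrt) (use ell2_nth[of x] assms in \<open>auto intro!: infsum_nonneg infsum_le_finite_sums\<close>)

instance ell2 :: (chilbert_space) chilbert_space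
proof
  fix X :: "nat \<Rightarrow> 'a ell2"
  assume X: "Cauchy X"
  have "Cauchy (\<lambda>k. ell2_nth (X k) n)" for n
  proof (rule CauchyI)
    fix e :: real assume "0 < e"
    then obtain M where "\<forall>k\<ge>M. \<forall>l\<ge>M. norm (X k - X l) < e"
      using CauchyD[OF X] by blast
    then show "\<exists>M. \<forall>k\<ge>M. \<forall>l\<ge>M. norm (ell2_nth (X k) n - ell2_nth (X l) n) < e"
      by (metis ell2_nth_minus norm_ell2_nth_le order_le_less_trans)
  qed
  then have "\<exists>L. (\<lambda>k. ell2_nth (X k) n) \<longlonglongrightarrow> L" for n
    using Cauchy_convergent convergent_def by blast
  then obtain y where y: "\<And>n. (\<lambda>k. ell2_nth (X k) n) \<longlonglongrightarrow> y n"
    by metis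
  have tail: "(\<Sum>n\<in>F. (norm (ell2_nth (X k) n - y n))\<^sup>2) \<le> e\<^sup>2"
    if "\<forall>k\<ge>M. \<forall>l\<ge>M. norm (X k - X l) < e" "k \<ge> M" "finite F" for e M k F
  proof (rule LIMSEQ_le_const2)
    show "(\<lambda>l. \<Sum>n\<in>F. (norm (ell2_nth (X k) n - ell2_nth (X l) n))\<^sup>2)
        \<longlonglongrightarrow> (\<Sum>n\<in>F. (norm (ell2_nth (X k) n - y n))\<^sup>2)"
      by (intro tendsto_intros y)
    have "(\<Sum>n\<in>F. (norm (ell2_nth (X k) n - ell2_nth (X l) n))\<^sup>2) \<le> e\<^sup>2" if "l \<ge> M" for l
    proof -
      have "(\<Sum>n\<in>F. (norm (ell2_nth (X k) n - ell2_nth (X l) n))\<^sup>2) \<le> (norm (X k - X l))\<^sup>2"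
        using sum_ell2_nth_le[OF \<open>finite F\<close>, of "X k - X l"] by (simp add: ell2_nth_minus)
      also have "\<dots> \<le> e\<^sup>2"
        using \<open>\<forall>k\<ge>M. \<forall>l\<ge>M. norm (X k - X l) < e\<close> \<open>k \<ge> M\<close> that
        by (intro power_mono) (auto intro: less_imp_le)
      finally show ?thesis .
    qed
    then show "\<exists>N. \<forall>l\<ge>N. (\<Sum>n\<in>F. (norm (ell2_nth (X k) n - ell2_nth (X l) n))\<^sup>2) \<le> e\<^sup>2"
      by blast
  qed
  have "(\<lambda>n. (norm (y n))\<^sup>2) summable_on UNIV"
  proof -
    obtain M where M: "\<forall>k\<ge>M. \<forall>l\<ge>M. norm (X k - X l) < 1"
      using CauchyD[OF X, of 1] by auto
    have "(\<lambda>n. (norm (ell2_nth (X M) n - y n))\<^sup>2) summable_on UNIV"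
    proof (rule nonneg_bdd_above_summable_on)
      show "bdd_above (sum (\<lambda>n. (norm (ell2_nth (X M) n - y n))\<^sup>2) ` {F. F \<subseteq> UNIV \<and> finite F})"
        using tail[OF M order_refl] by (intro bdd_aboveI2) blast
    qed simp
    then have "(\<lambda>n. (norm (y n - ell2_nth (X M) n))\<^sup>2) summable_on UNIV"
      by (subst norm_minus_commute)
    from square_summable_add[OF ell2_nth[of "X M", unfolded mem_Collect_eq] this]
    show ?thesis by simp
  qed
  then have nth: "ell2_nth (Abs_ell2 y) = y"
    by (simp add: Abs_ell2_inverse)
  have "X \<longlonglongrightarrow> Abs_ell2 y"
  proof (rule LIMSEQ_I)
    fix e :: real assume "0 < e"
    then obtain M where M: "\<forall>k\<ge>M. \<forall>l\<ge>M. norm (X k - X l) < e / 2"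
      using CauchyD[OF X, of "e / 2"] by auto
    have "norm (X k - Abs_ell2 y) \<le> e / 2" if "k \<ge> M" for k
      by (rule norm_ell2_leI) (use \<open>0 < e\<close> tail[OF M that] in \<open>auto simp: ell2_nth_minus nth\<close>)
    then show "\<exists>M. \<forall>k\<ge>M. norm (X k - Abs_ell2 y) < e"
      using \<open>0 < e\<close> by (intro exI[of _ M]) fastforce
  qed
  then show "convergent X"
    by (auto simp: convergent_def)
qed

section \<open>Operator matrices and weighted shifts\<close>

definition has_op_matrix ::
  "('a :: complex_inner ell2 \<Rightarrow> 'a ell2) \<Rightarrow> (int \<Rightarrow> int \<Rightarrow> 'a \<Rightarrow> 'a) \<Rightarrow> bool" where
  "has_op_matrix U M \<longleftrightarrow> (\<forall>i j. M i j \<in> bounded_ops) \<and>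
     (\<forall>x i. ((\<lambda>j. M i j (ell2_nth x j)) has_sum ell2_nth (U x) i) UNIV)"

definition bilateral_weighted_shift ::
  "('a :: complex_inner ell2 \<Rightarrow> 'a ell2) \<Rightarrow> (int \<Rightarrow> 'a \<Rightarrow> 'a) \<Rightarrow> bool" where
  "bilateral_weighted_shift S W \<longleftrightarrow>
     S \<in> bounded_ops \<and> (\<forall>n. W n \<in> bounded_ops \<and> W n \<noteq> (\<lambda>_. 0)) \<and>
     bdd_above (range (\<lambda>n. onorm (W n))) \<and>
     (\<forall>x n. ell2_nth (S x) n = W n (ell2_nth x (n - 1)))"

lift_definition ell2_single :: "int \<Rightarrow> 'a \<Rightarrow> 'a :: real_normed_vector ell2" is
  "\<lambda>j h n. if n = j then h else 0"
proof -
  fix j :: int and h :: 'a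
  have "((\<lambda>n. (norm (if n = j then h else 0))\<^sup>2) has_sum (norm h)\<^sup>2) UNIV"
    by (rule has_sum_finite_neutralI[of "{j}"]) auto
  then show "(\<lambda>n. (norm (if n = j then h else 0))\<^sup>2) summable_on UNIV"
    by (rule has_sum_imp_summable)
qed

lemma has_op_matrix_entry:
  assumes "has_op_matrix U M"
  shows "M i j h = ell2_nth (U (ell2_single j h)) i"
proof -
  have z: "M i l 0 = 0" for l
  proof -
    have "bounded_linear (M i l)"
      using assms by (simp add: has_op_matrix_def bounded_ops_def)
    then show ?thesis
      by (intro linear_0 bounded_linear.linear)
  qed
  have "((\<lambda>l. M i l (ell2_nth (ell2_single j h) l)) has_sum ell2_nth (U (ell2_single j h)) i) UNIV"
    using assms by (auto simp: has_op_matrix_def)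
  moreover have "((\<lambda>l. M i l (ell2_nth (ell2_single j h) l)) has_sum M i j h) UNIV"
    by (rule has_sum_finite_neutralI[of "{j}"]) (auto simp: ell2_single.rep_eq z)
  ultimately show ?thesis
    using has_sum_unique by blast
qed

end

(* The intertwining U S = T U, with T = U S U* and invertible weights, shows that on each diagonal
   of U the entries either all vanish or are all nonzero; suppose no diagonal vanishes.
   If C_k C_k* e = e with e nonzero, then the isometry U maps the vector supported at k + 1 with
   entry C_k* e to the vector supported at k with entry e, so e is orthogonal to the ranges of A_k
   and B_k. Columns k - 1 and k + 1 give that the ranges of A_k and C_k are orthogonal, so in dimension
   two the range of C_k is spanned by e and is orthogonal to that of B_k. Columns k and k + 1
   then make the ranges of A_(k+1) and B_(k+1) orthogonal. Both are orthogonal to the corresponding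
   vector e for k + 1, which gives three mutually orthogonal nonzero vectors in dimension two. *)
theory Submission
  imports Defs
begin

section \<open>Two-dimensional complex inner product spaces\<close>

lemma cinner_zero_left [simp]: "cinner 0 (y :: 'a :: complex_inner) = 0"
  using cinner_add_left[of 0 0 y] by simp

lemma cinner_zero_right [simp]: "cinner (x :: 'a :: complex_inner) 0 = 0"
  using cinner_add_right[of x 0 0] by simp

lemma cinner_diff_left: "cinner (x - y) (z :: 'a :: complex_inner) = cinner x z - cinner y z"
  using cinner_add_left[of "x - y" y z] by simp

lemma cinner_diff_right: "cinner z (x - y :: 'a :: complex_inner) = cinner z x - cinner z y"
  using cinner_add_right[of z "x - y" y] by simp

lemma cinner_self_eq_0_iff [simp]: "cinner x x = 0 \<longleftrightarrow> (x :: 'a :: complex_inner) = 0"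
  by (simp add: cinner_self)

lemma cinner_eq_0_commute: "cinner x y = 0 \<longleftrightarrow> cinner y (x :: 'a :: complex_inner) = 0"
  by (subst cinner_commute) simp

text \<open>The factor 2 comes from applying real Cauchy-Schwarz to the real and imaginary parts
  separately. This crude form suffices for showing operators bounded.\<close>

lemma norm_cinner_le: "norm (cinner x y) \<le> 2 * (norm x * norm (y :: 'a :: complex_inner))"
proof -
  have "norm (cinner x y) \<le> \<bar>inner x y\<bar> + \<bar>inner x (\<i> *\<^sub>C y)\<bar>"
    using cmod_le[of "cinner x y"] by (simp add: cinner_eq_Complex)
  also have "\<dots> \<le> norm x * norm y + norm x * norm (\<i> *\<^sub>C y)"
    by (intro add_mono Cauchy_Schwarz_ineq2)
  finally show ?thesis by (simp add: norm_scaleC)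
qed

text \<open>\<open>card\<close> is 0 on infinite sets, so a nonzero \<open>dim\<close> forces a
  finite basis.\<close>

lemma finite_dimensional_vector_space_scaleC:
  assumes "complex_vector.dim (UNIV :: 'h :: complex_vector set) \<noteq> 0"
  obtains Bs :: "'h :: complex_vector set" where "finite_dimensional_vector_space scaleC Bs"
proof -
  obtain Bs :: "'h set" where "complex_vector.independent Bs" "UNIV \<subseteq> complex_vector.span Bs"
      "card Bs = complex_vector.dim (UNIV :: 'h set)"
    using complex_vector.basis_exists[of UNIV] by metis
  with assms have "finite_dimensional_vector_space scaleC Bs"
    by unfold_locales (auto intro: card_ge_0_finite)
  then show ?thesis ..
qed

text \<open>Two nonzero orthogonal vectors are independent and hence span; pairing with
  \<open>e\<close> and with \<open>a\<close> isolates the two coefficients.\<close>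

lemma orthogonal_basis_expansion:
  fixes e a x :: "'h :: complex_inner"
  assumes dim: "complex_vector.dim (UNIV :: 'h set) = 2"
    and ne: "e \<noteq> 0" "a \<noteq> 0" and ea: "cinner e a = 0"
  shows "x = (cinner x e / cinner e e) *\<^sub>C e + (cinner x a / cinner a a) *\<^sub>C a"
proof -
  obtain Bs :: "'h set" where "finite_dimensional_vector_space scaleC Bs"
    using finite_dimensional_vector_space_scaleC dim by (metis zero_neq_numeral)
  then interpret finite_dimensional_vector_space "scaleC :: complex \<Rightarrow> 'h \<Rightarrow> 'h" Bs .
  have ae: "cinner a e = 0"
    using ea cinner_eq_0_commute by blast
  have "e \<notin> complex_vector.span {a}"
    using ea ne by (auto simp: complex_vector.span_singleton cinner_scaleC_left)
  moreover have "complex_vector.independent {a}"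
    using ne by simp
  ultimately have ind: "complex_vector.independent {e, a}"
    by (simp add: complex_vector.independent_insert)
  have "e \<noteq> a" using ea ne by auto
  then have "UNIV \<subseteq> complex_vector.span {e, a}"
    using ind dim by (intro card_ge_dim_independent) auto
  then obtain s t where "x - s *\<^sub>C e = t *\<^sub>C a"
    using complex_vector.span_breakdown_eq[of x e "{a}"]
    by (auto simp: complex_vector.span_singleton)
  then have x: "x = s *\<^sub>C e + t *\<^sub>C a"
    by (metis diff_add_cancel add.commute)
  show ?thesis
    by (simp add: x cinner_add_left cinner_scaleC_left ea ae ne)
qed

text \<open>In dimension two the orthogonal complement of \<open>a\<close> is the line through
  \<open>e\<close>, so \<open>c\<close> is a multiple of \<open>e\<close>, to which \<open>b\<close>
  is orthogonal.\<close>

lemma orthogonal_transfer: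
  fixes e a b c :: "'h :: complex_inner"
  assumes "complex_vector.dim (UNIV :: 'h set) = 2"
    and "e \<noteq> 0" "a \<noteq> 0" "cinner e a = 0"
    and "cinner e b = 0" "cinner a c = 0"
  shows "cinner b c = 0"
proof -
  have "cinner c a = 0" "cinner b e = 0"
    using assms cinner_eq_0_commute by blast+
  then have "c = (cinner c e / cinner e e) *\<^sub>C e"
    using orthogonal_basis_expansion[OF assms(1-4), of c] by simp
  with \<open>cinner b e = 0\<close> show ?thesis
    by (metis cinner_scaleC_right mult_zero_right)
qed

lemma exists_orthogonal_basis:
  assumes dim: "complex_vector.dim (UNIV :: 'h :: complex_inner set) = 2"
  obtains e a :: "'h :: complex_inner" where "e \<noteq> 0" "a \<noteq> 0" "cinner e a = 0"
proof -
  obtain Bs :: "'h set" where Bs: "complex_vector.independent Bs" "card Bs = 2"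
    using complex_vector.basis_exists[of UNIV] dim by metis
  then obtain u v where uv: "Bs = {u, v}" "u \<noteq> v"
    by (auto simp: card_2_iff)
  have u: "u \<noteq> 0"
    using Bs uv complex_vector.dependent_zero[of Bs] by auto
  have v: "v \<notin> complex_vector.span {u}"
    using Bs uv complex_vector.independent_insert[of v "{u}"] by (simp add: insert_commute)
  \<comment> \<open>Gram-Schmidt: the component of \<open>v\<close> along \<open>u\<close> is
    removed; what remains is nonzero because \<open>v\<close> lies off that line.\<close>
  define a where "a = v - (cinner v u / cinner u u) *\<^sub>C u"
  have "a \<noteq> 0"
    using v by (auto simp: a_def complex_vector.span_singleton)
  moreover have "cinner a u = 0"
    by (simp add: a_def cinner_diff_left cinner_scaleC_left u)
  ultimately show ?thesis
    using that[OF u] cinner_eq_0_commute by blast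
qed

section \<open>Bounded operators and eigenvectors in dimension two\<close>

lemma scaleC_linear_bounded:
  fixes L :: "'h :: complex_inner \<Rightarrow> 'h"
  assumes dim: "complex_vector.dim (UNIV :: 'h set) = 2"
    and add: "\<And>x y. L (x + y) = L x + L y" and scale: "\<And>c x. L (c *\<^sub>C x) = c *\<^sub>C L x"
  shows "L \<in> bounded_ops"
proof -
  obtain e a :: 'h where ea: "e \<noteq> 0" "a \<noteq> 0" "cinner e a = 0"
    by (rule exists_orthogonal_basis[OF dim])
  \<comment> \<open>\<open>L\<close> is determined by its values at \<open>e\<close> and
    \<open>a\<close>; \<open>K u\<close> bounds the term of the expansion of \<open>L x\<close> that
    comes from \<open>u\<close>.\<close>
  define K where "K u = 2 * norm u / norm (cinner u u) * norm (L u)" for u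
  have *: "norm ((cinner x u / cinner u u) *\<^sub>C L u) \<le> norm x * K u" if "u \<noteq> 0" for x u
    using mult_right_mono[OF norm_cinner_le[of x u], of "norm (L u) / norm (cinner u u)"] that
    by (simp add: norm_scaleC norm_divide K_def field_simps)
  have "bounded_linear L"
  proof (rule bounded_linear_intro[of _ "K e + K a"])
    fix x
    have "L x = (cinner x e / cinner e e) *\<^sub>C L e + (cinner x a / cinner a a) *\<^sub>C L a"
      by (subst orthogonal_basis_expansion[OF dim ea, of x]) (simp only: add scale)
    then show "norm (L x) \<le> norm x * (K e + K a)"
      using norm_triangle_mono[OF *[OF ea(1), of x] *[OF ea(2), of x]]
      by (simp add: distrib_left)
  qed (simp_all add: add scale scaleR_eq_scaleC)
  then show ?thesis
    by (simp add: bounded_ops_def scale)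
qed

lemma bounded_ops_linear:
  assumes "A \<in> bounded_ops"
  shows "A (x + y) = A x + A y" "A (x - y) = A x - A y" "A 0 = 0" "A (c *\<^sub>C x) = c *\<^sub>C A x"
  using assms by (auto simp: bounded_ops_def bounded_linear.linear linear_add linear_diff linear_0)

text \<open>Without an eigenvector \<open>T - c\<close> is injective, hence surjective in finite
  dimension. Its inverse is linear and therefore bounded, which would put \<open>c\<close> outside
  the spectrum.\<close>

lemma op_spectrum_eigenvector:
  fixes T :: "'h :: complex_inner \<Rightarrow> 'h"
  assumes dim: "complex_vector.dim (UNIV :: 'h set) = 2"
    and T: "T \<in> bounded_ops" and c: "c \<in> op_spectrum T"
  obtains e where "e \<noteq> 0" "T e = c *\<^sub>C e"
proof (rule ccontr)
  assume "\<not> thesis"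
  then have none: "T x = c *\<^sub>C x \<Longrightarrow> x = 0" for x
    using that by blast
  define L where "L x = T x - c *\<^sub>C x" for x
  have add: "L (x + y) = L x + L y" and scale: "L (d *\<^sub>C x) = d *\<^sub>C L x" for x y d
    by (simp_all add: L_def bounded_ops_linear[OF T] scaleC_add_right scaleC_scaleC
        complex_vector.scale_right_diff_distrib mult.commute)
  have "Vector_Spaces.linear scaleC scaleC L"
    by unfold_locales (simp_all add: add scale)
  moreover have inj: "inj L"
  proof (rule injI)
    fix x y assume "L x = L y"
    then have "T (x - y) = c *\<^sub>C (x - y)"
      by (simp add: L_def bounded_ops_linear[OF T] complex_vector.scale_right_diff_distrib
          algebra_simps)
    then show "x = y" using none by fastforce
  qed
  ultimately have surj: "surj L"
    using finite_dimensional_vector_space_scaleC[where 'h = 'h] dim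
    by (metis finite_dimensional_vector_space.linear_inj_imp_surj zero_neq_numeral)
  define R where "R = inv L"
  have LR: "L (R x) = x" and RL: "R (L x) = x" for x
    by (simp_all add: R_def surj surj_f_inv_f inj)
  have "R \<in> bounded_ops"
  proof (rule scaleC_linear_bounded[OF dim])
    show "R (x + y) = R x + R y" for x y
      using RL[of "R x + R y"] by (simp add: add LR)
    show "R (d *\<^sub>C x) = d *\<^sub>C R x" for x d
      using RL[of "d *\<^sub>C R x"] by (simp add: scale LR)
  qed
  moreover have "L \<in> bounded_ops"
    by (rule scaleC_linear_bounded[OF dim add scale])
  moreover have "L \<circ> R = id" "R \<circ> L = id"
    by (simp_all add: fun_eq_iff LR RL)
  ultimately have "op_invertible L"
    unfolding op_invertible_def by blast
  with c show False
    by (simp add: op_spectrum_def L_def[abs_def])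
qed

section \<open>Operators on two-sided sequences\<close>

lemma cinner_ell2_finite:
  fixes x y :: "'h :: complex_inner ell2"
  assumes "finite F" "\<And>n. n \<notin> F \<Longrightarrow> ell2_nth x n = 0 \<or> ell2_nth y n = 0"
  shows "cinner x y = (\<Sum>n\<in>F. cinner (ell2_nth x n) (ell2_nth y n))"
proof -
  have "cinner x y = (\<Sum>\<^sub>\<infinity>n\<in>F. cinner (ell2_nth x n) (ell2_nth y n))"
    unfolding cinner_ell2_def
    by (rule infsum_cong_neutral) (use assms(2) in force)+
  with assms(1) show ?thesis by simp
qed

lemma cinner_ell2_single_left: "cinner (ell2_single j h) x = cinner h (ell2_nth x j)"
  by (subst cinner_ell2_finite[of "{j}"]) (auto simp: ell2_single.rep_eq)

lemma cinner_ell2_single_single: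
  "cinner (ell2_single j h) (ell2_single l g) = (if j = l then cinner h g else 0)"
  by (simp add: cinner_ell2_single_left ell2_single.rep_eq)

lemma unitary_op_cinner:
  assumes "unitary_op U"
  shows "cinner (U x) (U y) = cinner x y"
  using assms adjoint_op(2)[of U x "U y"] by (simp add: unitary_op_def fun_eq_iff)

text \<open>Since \<open>c\<close> is a self inner product it is real, so
  \<open>cinner (x - y) (x - y)\<close> expands to c - c - c + c. This identifies a vector of
  \<open>ell2\<close> without computing all its coordinates.\<close>

lemma eq_if_cinner_eq:
  fixes x y :: "'a :: complex_inner"
  assumes "cinner x x = c" "cinner y y = c" "cinner x y = c"
  shows "x = y"
proof -
  have "cinner y x = cnj (cinner y y)"
    using assms by (metis cinner_commute)
  also have "\<dots> = c"
    using assms by (metis cinner_commute)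
  finally have "cinner (x - y) (x - y) = 0"
    using assms by (simp add: cinner_diff_left cinner_diff_right)
  then show ?thesis by simp
qed

section \<open>Weighted shifts and the diagonals of an intertwining operator\<close>

lemma bilateral_weighted_shift_single:
  assumes "bilateral_weighted_shift S V"
  shows "S (ell2_single j h) = ell2_single (j + 1) (V (j + 1) h)"
proof (rule ell2_eqI)
  fix n
  have "V n 0 = 0"
    using assms by (intro bounded_ops_linear(3)) (simp add: bilateral_weighted_shift_def)
  then show "ell2_nth (S (ell2_single j h)) n = ell2_nth (ell2_single (j + 1) (V (j + 1) h)) n"
    using assms by (auto simp: bilateral_weighted_shift_def ell2_single.rep_eq)
qed

lemma op_invertible_bij: "op_invertible A \<Longrightarrow> bij A"
  unfolding op_invertible_def using o_bij by metis

text \<open>The number \<open>d\<close> selects a diagonal: -1, 0 and 1 give the \<open>A\<close>,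
  \<open>B\<close> and \<open>C\<close> of the theorem. Comparing entries of US = TU links
  neighbours on a diagonal through invertible weights, so a zero spreads in both directions.\<close>

lemma shift_intertwining_diagonal:
  fixes M :: "int \<Rightarrow> int \<Rightarrow> 'h :: complex_inner \<Rightarrow> 'h"
  assumes U: "has_op_matrix U M"
    and S: "bilateral_weighted_shift S V" "\<And>n. op_invertible (V n)"
    and T: "bilateral_weighted_shift T W" "\<And>n. op_invertible (W n)"
    and US: "U \<circ> S = T \<circ> U"
    and zero: "M m (m + d) = (\<lambda>_. 0)"
  shows "M n (n + d) = (\<lambda>_. 0)"
proof -
  \<comment> \<open>This is entry \<open>(i, i - 1 + d)\<close> of US = TU: \<open>S\<close> moves
    the support from \<open>i - 1 + d\<close> to \<open>i + d\<close>, while row \<open>i\<close> of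
    \<open>T\<close> reads coordinate \<open>i - 1\<close>.\<close>
  have rel: "M i (i + d) (V (i + d) h) = W i (M (i - 1) (i - 1 + d) h)" for i h
  proof -
    have "M i (i + d) (V (i + d) h) = ell2_nth (U (S (ell2_single (i - 1 + d) h))) i"
      by (simp add: has_op_matrix_entry[OF U] bilateral_weighted_shift_single[OF S(1)] algebra_simps)
    also have "\<dots> = ell2_nth (T (U (ell2_single (i - 1 + d) h))) i"
      using US by (metis comp_apply)
    also have "\<dots> = W i (M (i - 1) (i - 1 + d) h)"
      using T(1) by (simp add: bilateral_weighted_shift_def has_op_matrix_entry[OF U])
    finally show ?thesis .
  qed
  have W0: "W i h = 0 \<longleftrightarrow> h = 0" for i h
    using op_invertible_bij[OF T(2)[of i]] T(2)[of i] bounded_ops_linear(3)[of "W i"]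
    by (metis bij_pointE op_invertible_def)
  have step: "M i (i + d) = (\<lambda>_. 0) \<longleftrightarrow> M (i - 1) (i - 1 + d) = (\<lambda>_. 0)" for i
  proof -
    \<comment> \<open>Surjectivity of the weight lets \<open>V (i + d) h\<close> range over all
      vectors, so \<open>rel\<close> applies.\<close>
    have "M i (i + d) = (\<lambda>_. 0) \<longleftrightarrow> (\<forall>h. M i (i + d) (V (i + d) h) = 0)"
      using op_invertible_bij[OF S(2)[of "i + d"]] by (metis bij_pointE)
    then show ?thesis
      by (auto simp: rel W0)
  qed
  show ?thesis
  proof (induction n rule: int_induct[of _ m])
    case base
    show ?case by (rule zero)
  next
    case (step1 i)
    then show ?case using step[of "i + 1"] by simp
  next
    case (step2 i)
    then show ?case using step[of i] by simp
  qed
qed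

section \<open>Orthogonality relations between the entries of a unitary matrix\<close>

lemma unitary_row_orthogonal:
  fixes M :: "int \<Rightarrow> int \<Rightarrow> 'h :: chilbert_space \<Rightarrow> 'h"
  assumes U: "unitary_op U" "has_op_matrix U M"
    and e: "(M i l \<circ> adjoint_op (M i l)) e = e" and "j \<noteq> l"
  shows "cinner e (M i j h) = 0"
proof -
  have "M i l \<in> bounded_ops"
    using U by (simp add: has_op_matrix_def)
  note adj = adjoint_op(2)[OF this]
  define f where "f = adjoint_op (M i l) e"
  have Mf: "M i l f = e"
    using e by (simp add: f_def)
  have ff: "cinner f f = cinner e e"
    using adj[of f e] by (simp add: Mf flip: f_def)
  \<comment> \<open>The image of \<open>ell2_single l f\<close> has squared norm
    \<open>cinner f f = cinner e e\<close>, and its coordinate \<open>i\<close> is already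
    \<open>e\<close>, so nothing is left for the others.\<close>
  have *: "ell2_single i e = U (ell2_single l f)"
    by (rule eq_if_cinner_eq[where c = "cinner e e"])
      (simp_all add: unitary_op_cinner[OF U(1)] cinner_ell2_single_left ell2_single.rep_eq
        has_op_matrix_entry[OF U(2), symmetric] Mf ff)
  have "cinner e (M i j h) = cinner (ell2_single i e) (U (ell2_single j h))"
    by (simp add: cinner_ell2_single_left has_op_matrix_entry[OF U(2)])
  also have "\<dots> = 0"
    unfolding * using \<open>j \<noteq> l\<close> by (simp add: unitary_op_cinner[OF U(1)] cinner_ell2_single_single)
  finally show ?thesis .
qed

text \<open>Distinct columns have orthogonal images under the isometry \<open>U\<close>;
  \<open>F\<close> collects the rows where both may be nonzero, which makes the inner product a
  finite sum.\<close>

lemma unitary_column_orthogonal: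
  fixes M :: "int \<Rightarrow> int \<Rightarrow> 'h :: chilbert_space \<Rightarrow> 'h"
  assumes U: "unitary_op U" "has_op_matrix U M" and "j \<noteq> l" and "finite F"
    and F: "\<And>i. i \<notin> F \<Longrightarrow> M i j = (\<lambda>_. 0) \<or> M i l = (\<lambda>_. 0)"
  shows "(\<Sum>i\<in>F. cinner (M i j x) (M i l y)) = 0"
proof -
  have "cinner (U (ell2_single j x)) (U (ell2_single l y)) = 0"
    using \<open>j \<noteq> l\<close> by (simp add: unitary_op_cinner[OF U(1)] cinner_ell2_single_single)
  moreover have "cinner (U (ell2_single j x)) (U (ell2_single l y)) =
      (\<Sum>i\<in>F. cinner (M i j x) (M i l y))"
    unfolding has_op_matrix_entry[OF U(2)]
    by (rule cinner_ell2_finite[OF \<open>finite F\<close>])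
      (use F in \<open>metis has_op_matrix_entry[OF U(2)]\<close>)
  ultimately show ?thesis by simp
qed

text \<open>Column \<open>j\<close> lives in rows \<open>j - 1\<close> to \<open>j + 1\<close>.
  Hence columns \<open>i - 1\<close> and \<open>i + 1\<close> meet only in row \<open>i\<close>, and
  columns \<open>i\<close> and \<open>i + 1\<close> only in rows \<open>i\<close> and
  \<open>i + 1\<close>.\<close>

lemma unitary_tridiagonal_columns:
  fixes M :: "int \<Rightarrow> int \<Rightarrow> 'h :: chilbert_space \<Rightarrow> 'h"
  assumes U: "unitary_op U" "has_op_matrix U M"
    and band: "\<And>i j. \<bar>i - j\<bar> \<ge> 2 \<Longrightarrow> M i j = (\<lambda>_. 0)"
  shows "cinner (M i (i - 1) x) (M i (i + 1) y) = 0"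
    and "cinner (M i i x) (M i (i + 1) y) + cinner (M (i + 1) i x) (M (i + 1) (i + 1) y) = 0"
proof -
  have "\<bar>n - (i - 1)\<bar> \<ge> 2 \<or> \<bar>n - (i + 1)\<bar> \<ge> 2" if "n \<notin> {i}" for n
    using that by auto
  then have "(\<Sum>n\<in>{i}. cinner (M n (i - 1) x) (M n (i + 1) y)) = 0"
    by (intro unitary_column_orthogonal[OF U]) (simp, simp, meson band)
  then show "cinner (M i (i - 1) x) (M i (i + 1) y) = 0"
    by simp
  have "\<bar>n - i\<bar> \<ge> 2 \<or> \<bar>n - (i + 1)\<bar> \<ge> 2" if "n \<notin> {i, i + 1}" for n
    using that by auto
  then have "(\<Sum>n\<in>{i, i + 1}. cinner (M n i x) (M n (i + 1) y)) = 0"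
    by (intro unitary_column_orthogonal[OF U]) (simp, simp, meson band)
  then show "cinner (M i i x) (M i (i + 1) y) + cinner (M (i + 1) i x) (M (i + 1) (i + 1) y) = 0"
    by simp
qed

lemma bounded_ops_comp:
  assumes "A \<in> bounded_ops" "B \<in> bounded_ops"
  shows "A \<circ> B \<in> bounded_ops"
  using assms by (auto simp: bounded_ops_def comp_def intro: bounded_linear_compose)

theorem proposition3p6:
  fixes A B C :: "int \<Rightarrow> 'h :: chilbert_space \<Rightarrow> 'h"
    and M :: "int \<Rightarrow> int \<Rightarrow> 'h \<Rightarrow> 'h"
    and U S :: "'h ell2 \<Rightarrow> 'h ell2"
  assumes "complex_vector.dim (UNIV :: 'h set) = 2"
    and "\<And>n. A n \<in> bounded_ops" and "\<And>n. B n \<in> bounded_ops" and "\<And>n. C n \<in> bounded_ops"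
    and "unitary_op U"
    and "has_op_matrix U M"
    and "\<And>n. M n (n - 1) = A n" and "\<And>n. M n n = B n" and "\<And>n. M n (n + 1) = C n"
    and "\<And>i j. \<bar>i - j\<bar> \<ge> 2 \<Longrightarrow> M i j = (\<lambda>_. 0)"
    and "\<exists>k. 1 \<in> op_spectrum (C k \<circ> adjoint_op (C k)) \<inter>
                 op_spectrum (C (k + 1) \<circ> adjoint_op (C (k + 1)))"
    and "S \<in> bounded_ops"
    and "\<exists>V. bilateral_weighted_shift S V \<and> (\<forall>n. op_invertible (V n))"
    and "\<exists>W. bilateral_weighted_shift (U \<circ> S \<circ> adjoint_op U) W \<and> (\<forall>n. op_invertible (W n))"
  shows "(\<forall>n. A n = (\<lambda>_. 0)) \<or> (\<forall>n. B n = (\<lambda>_. 0)) \<or> (\<forall>n. C n = (\<lambda>_. 0))"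
proof (rule ccontr)
  note dim = assms(1) and U = assms(5,6) and entries = assms(7-9) and band = assms(10)
  assume nz: "\<not> ?thesis"
  obtain V W where V: "bilateral_weighted_shift S V" "\<And>n. op_invertible (V n)"
    and W: "bilateral_weighted_shift (U \<circ> S \<circ> adjoint_op U) W" "\<And>n. op_invertible (W n)"
    using assms(13,14) by blast
  have US: "U \<circ> S = U \<circ> S \<circ> adjoint_op U \<circ> U"
    using U(1) by (simp add: unitary_op_def comp_assoc)
  note diag = shift_intertwining_diagonal[OF U(2) V W US]
  have Anz: "A n \<noteq> (\<lambda>_. 0)" for n
    using diag[of n "-1"] entries nz by (metis diff_conv_add_uminus)
  have Bnz: "B n \<noteq> (\<lambda>_. 0)" for n
    using diag[of n 0] entries nz by (metis add_0_right)
  obtain k where k: "1 \<in> op_spectrum (C k \<circ> adjoint_op (C k))"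
    "1 \<in> op_spectrum (C (k + 1) \<circ> adjoint_op (C (k + 1)))"
    using assms(11) by blast
  have eig: "\<exists>e. e \<noteq> 0 \<and> (\<forall>x. cinner e (A n x) = 0) \<and> (\<forall>x. cinner e (B n x) = 0)"
    if n: "1 \<in> op_spectrum (C n \<circ> adjoint_op (C n))" for n
  proof -
    obtain e where e: "e \<noteq> 0" "(C n \<circ> adjoint_op (C n)) e = 1 *\<^sub>C e"
      using op_spectrum_eigenvector[OF dim bounded_ops_comp n] assms(4) adjoint_op(1) by metis
    then have "(C n \<circ> adjoint_op (C n)) e = e"
      by (simp add: scaleC_one)
    \<comment> \<open>\<open>C n\<close> stands in column \<open>n + 1\<close>; columns
      \<open>n - 1\<close> and \<open>n\<close> of the same row then yield the claims for
      \<open>A n\<close> and \<open>B n\<close>.\<close>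
    then have "cinner e (M n j x) = 0" if "j \<noteq> n + 1" for j x
      using unitary_row_orthogonal[OF U, of n "n + 1" e j x] that entries(3)[of n] by simp
    from this[of "n - 1"] this[of n] show ?thesis
      using e(1) by (auto simp: entries(1,2))
  qed
  obtain e where e: "e \<noteq> 0" "\<And>x. cinner e (A k x) = 0" "\<And>x. cinner e (B k x) = 0"
    using eig[OF k(1)] by blast
  obtain e' where e': "e' \<noteq> 0" "\<And>x. cinner e' (A (k + 1) x) = 0" "\<And>x. cinner e' (B (k + 1) x) = 0"
    using eig[OF k(2)] by blast
  have AC: "cinner (A k x) (C k y) = 0" for x y
    using unitary_tridiagonal_columns(1)[OF U band, of k x y] by (simp add: entries(1,3))
  obtain x where "A k x \<noteq> 0"
    using Anz[of k] by blast
  \<comment> \<open>The nonzero vector \<open>A k x\<close> serves as \<open>a\<close>: the range of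
    \<open>C k\<close> lies on the line of \<open>e\<close>, to which the range of
    \<open>B k\<close> is orthogonal.\<close>
  then have BC: "cinner (B k y) (C k z) = 0" for y z
    using orthogonal_transfer[OF dim e(1) _ e(2) e(3) AC] by blast
  \<comment> \<open>Of the two terms in the relation for columns \<open>k\<close> and
    \<open>k + 1\<close>, the one in row \<open>k\<close> vanishes by \<open>BC\<close>.\<close>
  have AB: "cinner (A (k + 1) y) (B (k + 1) z) = 0" for y z
    using unitary_tridiagonal_columns(2)[OF U band, of k y z] BC[of y z] entries(1)[of "k + 1"]
    by (simp add: entries(2,3))
  obtain y z where yz: "A (k + 1) y \<noteq> 0" "B (k + 1) z \<noteq> 0"
    using Anz[of "k + 1"] Bnz[of "k + 1"] by blast
  \<comment> \<open>Here \<open>b\<close> and \<open>c\<close> of \<open>orthogonal_transfer\<close>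
    are the same vector, orthogonal to both \<open>e'\<close> and
    \<open>A (k + 1) y\<close>.\<close>
  have "cinner (B (k + 1) z) (B (k + 1) z) = 0"
    by (rule orthogonal_transfer[OF dim e'(1) yz(1) e'(2) e'(3) AB])
  with yz show False by simp
qed

end
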